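(* Let $\vec X=(X_0,X_1)$ be an interpolation couple of compatible Banach lattices, and let $X$ be an intermediate space. Then: (a) For every $f,g\in X_0+X_1$, $g\ll_K f$ implies $g\preceq_K 2f$. In particular, if $X$ is $K$-monotone, then $X$ is partially $K$-monotone. (b) If $X$ is an exact $K$-monotone space, then $X$ is a Banach lattice and an order ideal in $X_0+X_1$. (c) If $X$ is an exact partially $K$-monotone space, then $X$ is a vector lattice and an order ideal in $X_0+X_1$, and for every $f\in X$ $$\tfrac12\,\|\,|f|\,\|_X\le\|f\|_X\le 2\,\|\,|f|\,\|_X.$$ The norm $\|f\|_*:=\|\,|f|\,\|_X$ ($f\in X$) is an equivalent norm for which $X$ becomes exactly $K$-monotone. (d) If $X$ is an exact partially $K$-monotone space, then the following are equivalent: (i) $X$ is an exact $K$-monotone space; (ii) $X$ is a Banach lattice; (iii) for every $f\in X$ one has $\|f\|_X=\|\,|f|\,\|_X$.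
   Context: Banach lattices are real. An interpolation couple $\vec X=(X_0,X_1)$ of Banach spaces is a pair of Banach spaces continuously embedded in a common Hausdorff topological vector space; $\|f\|_{X_0\cap X_1}=\|f\|_{X_0}+\|f\|_{X_1}$ and $\|f\|_{X_0+X_1}=\inf\{\|f_0\|_{X_0}+\|f_1\|_{X_1}:f_i\in X_i,\ f=f_0+f_1\}$. It is an interpolation couple of compatible Banach lattices if $X_0$, $X_1$ and $X_0+X_1$ are Banach lattices and $X_0$, $X_1$ are order ideals in $X_0+X_1$. An intermediate space is a Banach space $X$ with $X_0\cap X_1\subseteq X\subseteq X_0+X_1$ with continuous embeddings. Write $f^+=f\vee0$, $f^-=(-f)\vee0$. The order on $X$ is that of $X_0+X_1$. $K(f,t)=\inf\{\|f_0\|_{X_0}+t\|f_1\|_{X_1}: f=f_0+f_1,\ f_i\in X_i\}$ for $f\in X_0+X_1$, $t\in(0,\infty)$. Write $g\preceq_K f$ if $K(g,\cdot)\le K(f,\cdot)$ pointwise on $(0,\infty)$, and $g\ll_K f$ if $g^+\preceq_K f^+$ and $g^-\preceq_K f^-$. $X$ is $K$-monotone (respectively partially $K$-monotone) if there is a constant $C\ge1$ such that for every $f\in X$ and $g\in X_0+X_1$, $g\preceq_K f$ (respectively $g\ll_K f$) implies $g\in X$ and $\|g\|_X\le C\|f\|_X$; it is exactly (partially) $K$-monotone, or an exact (partially) $K$-monotone space, if this holds with $C=1$. *)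

theory Defs
  imports "HOL-Analysis.Analysis" "HOL-Algebra.Lattice"
begin

section \<open>Banach spaces inside an ambient real vector space\<close>

text \<open>A space is a set of vectors of an ambient real vector space together with a norm.
  The values of the norm outside that set carry no meaning.\<close>

record 'a nspace =
  vecs :: "'a set"
  nrm :: "'a \<Rightarrow> real"

definition is_norm_on :: "'a::real_vector set \<Rightarrow> ('a \<Rightarrow> real) \<Rightarrow> bool" where
  "is_norm_on V n \<longleftrightarrow>
     (\<forall>x\<in>V. 0 \<le> n x) \<and>
     (\<forall>x\<in>V. n x = 0 \<longleftrightarrow> x = 0) \<and>
     (\<forall>x\<in>V. \<forall>c. n (c *\<^sub>R x) = \<bar>c\<bar> * n x) \<and>
     (\<forall>x\<in>V. \<forall>y\<in>V. n (x + y) \<le> n x + n y)"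

text \<open>The locale \<open>Metric_space\<close> wants symmetry and nonnegativity of the distance on the whole
  type, hence the value 0 off the carrier.\<close>

definition nspace_dist :: "'a::real_vector nspace \<Rightarrow> 'a \<Rightarrow> 'a \<Rightarrow> real" where
  "nspace_dist X x y = (if x \<in> vecs X \<and> y \<in> vecs X then nrm X (x - y) else 0)"

definition nspace_topology :: "'a::real_vector nspace \<Rightarrow> 'a topology" where
  "nspace_topology X = Metric_space.mtopology (vecs X) (nspace_dist X)"

definition banach_space :: "'a::real_vector nspace \<Rightarrow> bool" where
  "banach_space X \<longleftrightarrow>
     subspace (vecs X) \<and> is_norm_on (vecs X) (nrm X) \<and>
     Metric_space.mcomplete (vecs X) (nspace_dist X)"

definition equivalent_norms :: "'a set \<Rightarrow> ('a \<Rightarrow> real) \<Rightarrow> ('a \<Rightarrow> real) \<Rightarrow> bool" where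
  "equivalent_norms V n m \<longleftrightarrow>
     (\<exists>c>0. \<exists>d>0. \<forall>x\<in>V. c * n x \<le> m x \<and> m x \<le> d * n x)"


section \<open>Vector lattices\<close>

text \<open>The order is a relation on the ambient type; each subset carries its restriction.\<close>

definition ord_on :: "'a set \<Rightarrow> ('a \<Rightarrow> 'a \<Rightarrow> bool) \<Rightarrow> 'a gorder" where
  "ord_on V leq = \<lparr>carrier = V, eq = (=), le = leq\<rparr>"

definition vector_lattice :: "'a::real_vector set \<Rightarrow> ('a \<Rightarrow> 'a \<Rightarrow> bool) \<Rightarrow> bool" where
  "vector_lattice V leq \<longleftrightarrow>
     subspace V \<and> Lattice.lattice (ord_on V leq) \<and>
     (\<forall>x\<in>V. \<forall>y\<in>V. \<forall>z\<in>V. leq x y \<longrightarrow> leq (x + z) (y + z)) \<and>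
     (\<forall>x\<in>V. \<forall>y\<in>V. \<forall>c\<ge>0. leq x y \<longrightarrow> leq (c *\<^sub>R x) (c *\<^sub>R y))"

definition pos_part :: "'a::real_vector set \<Rightarrow> ('a \<Rightarrow> 'a \<Rightarrow> bool) \<Rightarrow> 'a \<Rightarrow> 'a" where
  "pos_part V leq f = f \<squnion>\<^bsub>ord_on V leq\<^esub> 0"

definition neg_part :: "'a::real_vector set \<Rightarrow> ('a \<Rightarrow> 'a \<Rightarrow> bool) \<Rightarrow> 'a \<Rightarrow> 'a" where
  "neg_part V leq f = (- f) \<squnion>\<^bsub>ord_on V leq\<^esub> 0"

definition vabs :: "'a::real_vector set \<Rightarrow> ('a \<Rightarrow> 'a \<Rightarrow> bool) \<Rightarrow> 'a \<Rightarrow> 'a" where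
  "vabs V leq f = f \<squnion>\<^bsub>ord_on V leq\<^esub> (- f)"

definition order_ideal :: "'a::real_vector set \<Rightarrow> 'a set \<Rightarrow> ('a \<Rightarrow> 'a \<Rightarrow> bool) \<Rightarrow> bool" where
  "order_ideal I V leq \<longleftrightarrow>
     subspace I \<and> I \<subseteq> V \<and>
     (\<forall>f\<in>I. \<forall>g\<in>V. leq (vabs V leq g) (vabs V leq f) \<longrightarrow> g \<in> I)"

definition banach_lattice :: "'a::real_vector nspace \<Rightarrow> ('a \<Rightarrow> 'a \<Rightarrow> bool) \<Rightarrow> bool" where
  "banach_lattice X leq \<longleftrightarrow>
     banach_space X \<and> vector_lattice (vecs X) leq \<and>
     (\<forall>f\<in>vecs X. \<forall>g\<in>vecs X.
        leq (vabs (vecs X) leq g) (vabs (vecs X) leq f) \<longrightarrow> nrm X g \<le> nrm X f)"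


section \<open>Interpolation couples\<close>

definition hausdorff_tvs :: "'a::real_vector topology \<Rightarrow> bool" where
  "hausdorff_tvs T \<longleftrightarrow>
     topspace T = UNIV \<and> Hausdorff_space T \<and>
     continuous_map (prod_topology T T) T (\<lambda>(x, y). x + y) \<and>
     continuous_map (prod_topology euclideanreal T) T (\<lambda>(c, x). c *\<^sub>R x)"

definition interpolation_couple :: "'a::real_vector nspace \<Rightarrow> 'a nspace \<Rightarrow> bool" where
  "interpolation_couple X0 X1 \<longleftrightarrow>
     banach_space X0 \<and> banach_space X1 \<and>
     (\<exists>T. hausdorff_tvs T \<and>
        continuous_map (nspace_topology X0) T (\<lambda>x. x) \<and>
        continuous_map (nspace_topology X1) T (\<lambda>x. x))"

definition inter_space :: "'a::real_vector nspace \<Rightarrow> 'a nspace \<Rightarrow> 'a nspace" where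
  "inter_space X0 X1 =
     \<lparr>vecs = vecs X0 \<inter> vecs X1, nrm = (\<lambda>f. nrm X0 f + nrm X1 f)\<rparr>"

definition sum_space :: "'a::real_vector nspace \<Rightarrow> 'a nspace \<Rightarrow> 'a nspace" where
  "sum_space X0 X1 =
     \<lparr>vecs = {f0 + f1 | f0 f1. f0 \<in> vecs X0 \<and> f1 \<in> vecs X1},
      nrm = (\<lambda>f. Inf {nrm X0 f0 + nrm X1 f1 | f0 f1.
                        f0 \<in> vecs X0 \<and> f1 \<in> vecs X1 \<and> f = f0 + f1})\<rparr>"

definition compatible_lattice_couple ::
  "'a::real_vector nspace \<Rightarrow> 'a nspace \<Rightarrow> ('a \<Rightarrow> 'a \<Rightarrow> bool) \<Rightarrow> bool" where
  "compatible_lattice_couple X0 X1 leq \<longleftrightarrow>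
     interpolation_couple X0 X1 \<and>
     banach_lattice X0 leq \<and> banach_lattice X1 leq \<and> banach_lattice (sum_space X0 X1) leq \<and>
     order_ideal (vecs X0) (vecs (sum_space X0 X1)) leq \<and>
     order_ideal (vecs X1) (vecs (sum_space X0 X1)) leq"

definition continuously_embedded :: "'a::real_vector nspace \<Rightarrow> 'a nspace \<Rightarrow> bool" where
  "continuously_embedded X Y \<longleftrightarrow>
     vecs X \<subseteq> vecs Y \<and> continuous_map (nspace_topology X) (nspace_topology Y) (\<lambda>x. x)"

definition intermediate_space :: "'a::real_vector nspace \<Rightarrow> 'a nspace \<Rightarrow> 'a nspace \<Rightarrow> bool" where
  "intermediate_space X0 X1 X \<longleftrightarrow>
     banach_space X \<and>
     continuously_embedded (inter_space X0 X1) X \<and>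
     continuously_embedded X (sum_space X0 X1)"


section \<open>K-monotonicity\<close>

definition K_fun :: "'a::real_vector nspace \<Rightarrow> 'a nspace \<Rightarrow> 'a \<Rightarrow> real \<Rightarrow> real" where
  "K_fun X0 X1 f t = Inf {nrm X0 f0 + t * nrm X1 f1 | f0 f1.
                            f0 \<in> vecs X0 \<and> f1 \<in> vecs X1 \<and> f = f0 + f1}"

definition K_le :: "'a::real_vector nspace \<Rightarrow> 'a nspace \<Rightarrow> 'a \<Rightarrow> 'a \<Rightarrow> bool" where
  "K_le X0 X1 g f \<longleftrightarrow> (\<forall>t>0. K_fun X0 X1 g t \<le> K_fun X0 X1 f t)"

definition K_ll ::
  "'a::real_vector nspace \<Rightarrow> 'a nspace \<Rightarrow> ('a \<Rightarrow> 'a \<Rightarrow> bool) \<Rightarrow> 'a \<Rightarrow> 'a \<Rightarrow> bool" where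
  "K_ll X0 X1 leq g f \<longleftrightarrow>
     (let S = vecs (sum_space X0 X1) in
        K_le X0 X1 (pos_part S leq g) (pos_part S leq f) \<and>
        K_le X0 X1 (neg_part S leq g) (neg_part S leq f))"

definition K_monotone_with ::
  "real \<Rightarrow> 'a::real_vector nspace \<Rightarrow> 'a nspace \<Rightarrow> 'a nspace \<Rightarrow> bool" where
  "K_monotone_with C X0 X1 X \<longleftrightarrow>
     (\<forall>f\<in>vecs X. \<forall>g\<in>vecs (sum_space X0 X1).
        K_le X0 X1 g f \<longrightarrow> g \<in> vecs X \<and> nrm X g \<le> C * nrm X f)"

definition partially_K_monotone_with ::
  "real \<Rightarrow> 'a::real_vector nspace \<Rightarrow> 'a nspace \<Rightarrow> ('a \<Rightarrow> 'a \<Rightarrow> bool) \<Rightarrow> 'a nspace \<Rightarrow> bool" where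
  "partially_K_monotone_with C X0 X1 leq X \<longleftrightarrow>
     (\<forall>f\<in>vecs X. \<forall>g\<in>vecs (sum_space X0 X1).
        K_ll X0 X1 leq g f \<longrightarrow> g \<in> vecs X \<and> nrm X g \<le> C * nrm X f)"

definition K_monotone :: "'a::real_vector nspace \<Rightarrow> 'a nspace \<Rightarrow> 'a nspace \<Rightarrow> bool" where
  "K_monotone X0 X1 X \<longleftrightarrow> (\<exists>C\<ge>1. K_monotone_with C X0 X1 X)"

definition partially_K_monotone ::
  "'a::real_vector nspace \<Rightarrow> 'a nspace \<Rightarrow> ('a \<Rightarrow> 'a \<Rightarrow> bool) \<Rightarrow> 'a nspace \<Rightarrow> bool" where
  "partially_K_monotone X0 X1 leq X \<longleftrightarrow> (\<exists>C\<ge>1. partially_K_monotone_with C X0 X1 leq X)"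

definition exactly_K_monotone :: "'a::real_vector nspace \<Rightarrow> 'a nspace \<Rightarrow> 'a nspace \<Rightarrow> bool" where
  "exactly_K_monotone X0 X1 X \<longleftrightarrow> K_monotone_with 1 X0 X1 X"

definition exactly_partially_K_monotone ::
  "'a::real_vector nspace \<Rightarrow> 'a nspace \<Rightarrow> ('a \<Rightarrow> 'a \<Rightarrow> bool) \<Rightarrow> 'a nspace \<Rightarrow> bool" where
  "exactly_partially_K_monotone X0 X1 leq X \<longleftrightarrow> partially_K_monotone_with 1 X0 X1 leq X"

end

theory Submission
  imports Defs
begin

text \<open>
  Everything rests on one property of the K-functional of a couple of lattices: it depends on the
  modulus only and is monotone in it, that is, \<open>|g| \<le> |f|\<close> implies \<open>K(g,t) \<le> K(f,t)\<close>
  (\<open>K_mono\<close>). Indeed, if \<open>f = f\<^sub>0 + f\<^sub>1\<close>, then \<open>|g| \<le> |f\<^sub>0| + |f\<^sub>1|\<close>, and Riesz decomposition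
  splits \<open>g\<close> into \<open>g\<^sub>0 + g\<^sub>1\<close> with \<open>|g\<^sub>i| \<le> |f\<^sub>i|\<close>; as the \<open>X\<^sub>i\<close> are ideals with monotone norms, this
  decomposition of \<open>g\<close> costs no more than the given one of \<open>f\<close>.

  For (a), both parts of \<open>f\<close> are dominated by \<open>|f|\<close>, so \<open>g \<ll>\<^sub>K f\<close> gives
  \<open>K(g,t) \<le> K(g\<^sup>+,t) + K(g\<^sup>-,t) \<le> K(f\<^sup>+,t) + K(f\<^sup>-,t) \<le> 2 K(f,t)\<close>.
  For (b), exact K-monotonicity turns \<open>K_mono\<close> into the statement that \<open>X\<close> is an ideal with
  monotone norm.

  For (c), between nonnegative vectors \<open>\<ll>\<^sub>K\<close> and \<open>\<preceq>\<^sub>K\<close> are the same relation, because the negative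
  parts vanish; so an exactly partially K-monotone norm is monotone on the positive
  cone. Moreover \<open>f\<^sup>+ \<ll>\<^sub>K f\<close> bounds \<open>\<parallel>f\<^sup>+\<parallel>\<close> by \<open>\<parallel>f\<parallel>\<close>, and the same bound for \<open>- f\<close> concerns \<open>f\<^sup>-\<close>.
  The two inequalities between \<open>\<parallel>f\<parallel>\<close> and \<open>\<parallel>|f|\<parallel>\<close> are then the triangle inequality for
  \<open>|f| = f\<^sup>+ + f\<^sup>-\<close> and for \<open>f = f\<^sup>+ - f\<^sup>-\<close>. The norm \<open>\<parallel>|f|\<parallel>\<close> is exactly K-monotone since
  \<open>g \<preceq>\<^sub>K f\<close> is the same as \<open>|g| \<ll>\<^sub>K |f|\<close>.

  For (d), (i) implies (ii) by (b). A Banach lattice norm does not distinguish \<open>f\<close> from \<open>|f|\<close>, which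
  is (iii). Under (iii) the norm of \<open>X\<close> is the exactly K-monotone norm of (c), which is (i).
\<close>

section \<open>Vector lattices carried by a set\<close>

lemma vabs_minus [simp]: "vabs V leq (- x) = vabs V leq x"
  by (simp add: vabs_def join_comm)

lemma pos_part_minus [simp]: "pos_part V leq (- x) = neg_part V leq x"
  by (simp add: pos_part_def neg_part_def)

locale vec_lattice =
  fixes V :: "'a::real_vector set" and leq :: "'a \<Rightarrow> 'a \<Rightarrow> bool"  (infix \<open>\<preceq>\<close> 50)
  assumes vector_lattice: "vector_lattice V leq"
begin

abbreviation "vjoin x y \<equiv> x \<squnion>\<^bsub>ord_on V leq\<^esub> y"
abbreviation "vmeet x y \<equiv> x \<sqinter>\<^bsub>ord_on V leq\<^esub> y"
abbreviation "pos \<equiv> pos_part V leq"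
abbreviation "neg \<equiv> neg_part V leq"
abbreviation "modulus \<equiv> vabs V leq"

lemma subspace_V: "subspace V"
  using vector_lattice by (simp add: vector_lattice_def)

lemma zero_in [simp]: "0 \<in> V"
  and add_in [simp]: "x \<in> V \<Longrightarrow> y \<in> V \<Longrightarrow> x + y \<in> V"
  and diff_in [simp]: "x \<in> V \<Longrightarrow> y \<in> V \<Longrightarrow> x - y \<in> V"
  and uminus_in [simp]: "x \<in> V \<Longrightarrow> - x \<in> V"
  and scale_in [simp]: "x \<in> V \<Longrightarrow> c *\<^sub>R x \<in> V"
  using subspace_V
  by (simp_all add: subspace_0 subspace_add subspace_diff subspace_neg subspace_scale)

lemma lattice_V: "Lattice.lattice (ord_on V leq)"
  using vector_lattice by (simp add: vector_lattice_def)

sublocale lat: Lattice.lattice "ord_on V leq"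
  rewrites "carrier (ord_on V leq) = V" and "le (ord_on V leq) = leq"
  by (rule lattice_V) (simp_all add: ord_on_def)

lemmas leq_refl [simp] = lat.le_refl
lemmas leq_trans = lat.le_trans
lemmas leq_antisym = lat.le_antisym

lemma join_least:
  "x \<preceq> z \<Longrightarrow> y \<preceq> z \<Longrightarrow> x \<in> V \<Longrightarrow> y \<in> V \<Longrightarrow> z \<in> V \<Longrightarrow> vjoin x y \<preceq> z"
  by (rule lat.join_le)

lemma leq_translate: "x \<preceq> y \<Longrightarrow> x \<in> V \<Longrightarrow> y \<in> V \<Longrightarrow> z \<in> V \<Longrightarrow> x + z \<preceq> y + z"
  using vector_lattice by (simp add: vector_lattice_def)

lemma leq_scale: "x \<preceq> y \<Longrightarrow> x \<in> V \<Longrightarrow> y \<in> V \<Longrightarrow> 0 \<le> c \<Longrightarrow> c *\<^sub>R x \<preceq> c *\<^sub>R y"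
  using vector_lattice by (simp add: vector_lattice_def)

text \<open>This lemma reduces the rearrangement of an inequality to an identity between vectors.\<close>

lemma leq_iff_diff: 
  assumes "x \<in> V" "y \<in> V" shows "x \<preceq> y \<longleftrightarrow> 0 \<preceq> y - x"
  using leq_translate[of x y "- x"] leq_translate[of 0 "y - x" x] assms by auto

lemma leq_add_mono:
  assumes "x \<preceq> y" "u \<preceq> v" "x \<in> V" "y \<in> V" "u \<in> V" "v \<in> V"
  shows "x + u \<preceq> y + v"
proof -
  have "x + u \<preceq> y + u" "u + y \<preceq> v + y"
    using assms by (auto intro: leq_translate)
  then show ?thesis
    using leq_trans[of "x + u" "y + u" "y + v"] assms by (simp add: add.commute)
qed

lemma leq_minus: "x \<preceq> y \<Longrightarrow> x \<in> V \<Longrightarrow> y \<in> V \<Longrightarrow> - y \<preceq> - x"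
  using leq_iff_diff[of x y] leq_iff_diff[of "- y" "- x"] by simp

lemma nonneg_half: 
  assumes "0 \<preceq> x + x" "x \<in> V" shows "0 \<preceq> x"
proof -
  have "(1/2::real) *\<^sub>R (x + x) = x"
    by (metis scaleR_half_double)
  then show ?thesis
    using leq_scale[of 0 "x + x" "1/2"] assms by simp
qed

lemma pos_in [simp]: "x \<in> V \<Longrightarrow> pos x \<in> V"
  and neg_in [simp]: "x \<in> V \<Longrightarrow> neg x \<in> V"
  and modulus_in [simp]: "x \<in> V \<Longrightarrow> modulus x \<in> V"
  by (simp_all add: pos_part_def neg_part_def vabs_def)

lemma leq_pos: "x \<in> V \<Longrightarrow> x \<preceq> pos x"
  and pos_nonneg: "x \<in> V \<Longrightarrow> 0 \<preceq> pos x"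
  and neg_nonneg: "x \<in> V \<Longrightarrow> 0 \<preceq> neg x"
  and leq_neg: "x \<in> V \<Longrightarrow> - x \<preceq> neg x"
  and leq_modulus: "x \<in> V \<Longrightarrow> x \<preceq> modulus x"
  and minus_leq_modulus: "x \<in> V \<Longrightarrow> - x \<preceq> modulus x"
  by (simp_all add: pos_part_def neg_part_def vabs_def lat.join_left lat.join_right)

lemma pos_least: "x \<preceq> z \<Longrightarrow> 0 \<preceq> z \<Longrightarrow> x \<in> V \<Longrightarrow> z \<in> V \<Longrightarrow> pos x \<preceq> z"
  and neg_least: "- x \<preceq> z \<Longrightarrow> 0 \<preceq> z \<Longrightarrow> x \<in> V \<Longrightarrow> z \<in> V \<Longrightarrow> neg x \<preceq> z"
  and modulus_least: "x \<preceq> z \<Longrightarrow> - x \<preceq> z \<Longrightarrow> x \<in> V \<Longrightarrow> z \<in> V \<Longrightarrow> modulus x \<preceq> z"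
  unfolding pos_part_def neg_part_def vabs_def by (rule join_least; simp)+

text \<open>Adding \<open>x \<le> |x|\<close> and \<open>- x \<le> |x|\<close> gives \<open>0 \<le> 2 |x|\<close>.\<close>

lemma modulus_nonneg: 
  assumes "x \<in> V" shows "0 \<preceq> modulus x"
proof (rule nonneg_half)
  show "0 \<preceq> modulus x + modulus x"
    using leq_add_mono[OF leq_modulus minus_leq_modulus, of x x] assms by simp
qed (use assms in simp)

lemma pos_eq_self: "0 \<preceq> x \<Longrightarrow> x \<in> V \<Longrightarrow> pos x = x"
  by (rule leq_antisym) (auto intro: pos_least leq_pos)

lemma neg_eq_0: "0 \<preceq> x \<Longrightarrow> x \<in> V \<Longrightarrow> neg x = 0"
  using leq_minus[of 0 x] by (intro leq_antisym) (auto intro: neg_least neg_nonneg)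

lemma modulus_eq_self: 
  assumes "0 \<preceq> x" "x \<in> V" shows "modulus x = x"
proof -
  have "- x \<preceq> x"
    using leq_minus[of 0 x] leq_trans[of "- x" 0 x] assms by simp
  then show ?thesis
    using assms by (intro leq_antisym) (auto intro: modulus_least leq_modulus)
qed

lemma modulus_modulus [simp]: "x \<in> V \<Longrightarrow> modulus (modulus x) = modulus x"
  by (simp add: modulus_eq_self modulus_nonneg)

text \<open>The vector \<open>x\<^sup>+ - x\<close> is an upper bound of \<open>- x\<close> and \<open>0\<close>, hence of \<open>x\<^sup>-\<close>. Likewise
  \<open>x\<^sup>- + x\<close> bounds \<open>x\<^sup>+\<close>.\<close>

lemma pos_minus_neg: 
  assumes x: "x \<in> V" shows "pos x - neg x = x"
proof -
  have "neg x \<preceq> pos x - x"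
    using x leq_pos[OF x] pos_nonneg[OF x]
      leq_iff_diff[of x "pos x"] leq_translate[of 0 "pos x" "- x"]
    by (intro neg_least) auto
  moreover have "pos x \<preceq> neg x + x"
    using x leq_neg[OF x] neg_nonneg[OF x]
      leq_iff_diff[of "- x" "neg x"] leq_translate[of 0 "neg x" x]
    by (intro pos_least) auto
  then have "pos x - x \<preceq> neg x"
    using leq_translate[of "pos x" "neg x + x" "- x"] x by simp
  ultimately have "neg x = pos x - x"
    using x by (intro leq_antisym) auto
  then show ?thesis by simp
qed

lemma pos_leq_modulus: "x \<in> V \<Longrightarrow> pos x \<preceq> modulus x"
  and neg_leq_modulus: "x \<in> V \<Longrightarrow> neg x \<preceq> modulus x"
  by (simp_all add: pos_least neg_least leq_modulus minus_leq_modulus modulus_nonneg)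

text \<open>For the less obvious inequality, \<open>(|x| + x)/2\<close> is an upper bound of \<open>x\<close> and \<open>0\<close>, hence
  \<open>2 x\<^sup>+ \<le> |x| + x\<close>, and \<open>2 x\<^sup>+ - x = x\<^sup>+ + x\<^sup>-\<close>.\<close>

lemma modulus_eq_pos_plus_neg: 
  assumes x: "x \<in> V" shows "modulus x = pos x + neg x"
proof (rule leq_antisym)
  show "modulus x \<preceq> pos x + neg x"
    using leq_add_mono[OF leq_pos neg_nonneg, of x x] 
      leq_add_mono[OF pos_nonneg leq_neg, of x x] x
    by (intro modulus_least) auto
  let ?h = "(1/2::real) *\<^sub>R (modulus x + x)"
  have "0 \<preceq> modulus x + x"
    using leq_iff_diff[of "- x" "modulus x"] minus_leq_modulus[OF x] x by simp
  then have "0 \<preceq> ?h"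
    using leq_scale[of 0 "modulus x + x" "1/2"] x by simp
  moreover have "x \<preceq> ?h"
    using leq_scale[of "x + x" "modulus x + x" "1/2"]
      leq_translate[of x "modulus x" x] leq_modulus[OF x] x
    by (simp add: scaleR_half_double del: scaleR_add_right)
  ultimately have "pos x \<preceq> ?h"
    using x by (intro pos_least) auto
  then have "pos x + pos x \<preceq> ?h + ?h"
    using x by (intro leq_add_mono) auto
  then have "pos x + pos x \<preceq> modulus x + x"
    by (metis scaleR_half_double scaleR_add_right)
  then have "pos x + pos x + (- x) \<preceq> modulus x + x + (- x)"
    using x by (intro leq_translate) auto
  moreover have "pos x + pos x + (- x) = pos x + neg x"
    using arg_cong[OF pos_minus_neg[OF x], of "\<lambda>z. pos x + (pos x - z)"] by simp
  ultimately show "pos x + neg x \<preceq> modulus x" 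
    by (metis add_minus_cancel add.commute)
qed (use x in auto)

lemma modulus_triangle: 
  assumes "x \<in> V" "y \<in> V" shows "modulus (x + y) \<preceq> modulus x + modulus y"
  using assms leq_add_mono[OF leq_modulus leq_modulus, of x y]
    leq_add_mono[OF minus_leq_modulus minus_leq_modulus, of x y]
  by (intro modulus_least) auto

text \<open>For \<open>c > 0\<close> the easy inequality \<open>|c x| \<le> c |x|\<close>, applied to \<open>1/c\<close> and \<open>c x\<close>, yields its own
  converse.\<close>

lemma modulus_scale: 
  assumes x: "x \<in> V" shows "modulus (c *\<^sub>R x) = \<bar>c\<bar> *\<^sub>R modulus x"
proof -
  have le: "modulus (c *\<^sub>R y) \<preceq> c *\<^sub>R modulus y" if "0 \<le> c" "y \<in> V" for c y
    using that leq_scale[of y "modulus y" c] leq_scale[of "- y" "modulus y" c]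
      leq_modulus minus_leq_modulus by (intro modulus_least) auto
  have pos: "modulus (c *\<^sub>R x) = c *\<^sub>R modulus x" if "0 < c" for c
  proof (rule leq_antisym)
    show "modulus (c *\<^sub>R x) \<preceq> c *\<^sub>R modulus x" using le that x by simp
    have "modulus (inverse c *\<^sub>R c *\<^sub>R x) \<preceq> inverse c *\<^sub>R modulus (c *\<^sub>R x)"
      by (rule le) (use that x in auto)
    then have "modulus x \<preceq> inverse c *\<^sub>R modulus (c *\<^sub>R x)" using that by simp
    from leq_scale[OF this, of c] show "c *\<^sub>R modulus x \<preceq> modulus (c *\<^sub>R x)"
      using that x by simp
  qed (use x in auto)
  show ?thesis
  proof (cases c "0::real" rule: linorder_cases)
    case less
    then show ?thesis
      using pos[of "- c"] by simp
  qed (simp_all add: pos modulus_eq_self)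
qed

lemma modulus_eq_0_iff: 
  assumes x: "x \<in> V" shows "modulus x = 0 \<longleftrightarrow> x = 0"
proof
  assume "modulus x = 0"
  then have "x \<preceq> 0" "- x \<preceq> 0"
    using leq_modulus[OF x] minus_leq_modulus[OF x] by auto
  then show "x = 0"
    using leq_minus[of "- x" 0] x by (intro leq_antisym) auto
qed (simp add: modulus_eq_self)

text \<open>Clamping \<open>g\<close> between \<open>- |x|\<close> and \<open>|x|\<close> gives the first summand. What the clamp cuts off 
  lies between \<open>- |y|\<close> and \<open>|y|\<close>, because \<open>g\<close> lies between \<open>\<plusminus>(|x| + |y|)\<close>.\<close>

lemma Riesz_decomposition:
  assumes g: "g \<in> V" and x: "x \<in> V" and y: "y \<in> V"
    and le: "modulus g \<preceq> modulus x + modulus y"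
  obtains u v where "u \<in> V" "v \<in> V" "g = u + v" "modulus u \<preceq> modulus x" "modulus v \<preceq> modulus y"
proof -
  define a b where "a = modulus x" and "b = modulus y"
  have ab [simp]: "a \<in> V" "b \<in> V" and a0: "0 \<preceq> a" and b0: "0 \<preceq> b"
    using x y by (simp_all add: a_def b_def modulus_nonneg)
  have up: "g \<preceq> a + b" and "- g \<preceq> a + b"
    using le g leq_modulus[OF g] minus_leq_modulus[OF g] leq_trans[of _ "modulus g" "a + b"]
    by (auto simp: a_def[symmetric] b_def[symmetric])
  then have low: "- (a + b) \<preceq> g"
    using leq_minus[of "- g" "a + b"] g by simp
  define u where "u = vjoin (vmeet g a) (- a)"
  have m [simp]: "vmeet g a \<in> V" and u [simp]: "u \<in> V"
    using g by (simp_all add: u_def)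
  have "- a \<preceq> a"
    using leq_minus[of 0 a] leq_trans[of "- a" 0 a] a0 by simp
  then have ua: "u \<preceq> a"
    unfolding u_def using g by (intro join_least) (auto intro: lat.meet_right)
  have au: "- a \<preceq> u"
    unfolding u_def using g by (intro lat.join_right) auto
  have g_add_b: "g + b \<in> V" "g - b \<in> V" using g by auto
  have "g + (- b) \<preceq> g + 0"
    using leq_minus[of 0 b] b0 g by (intro leq_add_mono) auto
  moreover have "g - b \<preceq> a"
    using leq_translate[OF up, of "- b"] g by simp
  ultimately have "g - b \<preceq> vmeet g a"
    using g by (intro lat.meet_le) auto
  moreover have "vmeet g a \<preceq> u"
    unfolding u_def using g by (intro lat.join_left) auto
  ultimately have "g - b \<preceq> u"
    using g by (blast intro: leq_trans[of "g - b" "vmeet g a" u] g_add_b m u)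
  then have vb: "g - u \<preceq> b"
    using leq_iff_diff[of "g - b" u] leq_iff_diff[of "g - u" b] g by (simp add: algebra_simps)
  have "g \<preceq> g + b"
    using leq_add_mono[of g g 0 b] b0 g by simp
  then have "vmeet g a \<preceq> g + b"
    using g leq_trans[of "vmeet g a" g "g + b"] lat.meet_left[of g a] by simp
  moreover have "- a \<preceq> g + b"
    using leq_translate[OF low, of b] g by simp
  ultimately have "u \<preceq> g + b"
    unfolding u_def using g by (intro join_least) auto
  then have bv: "- (g - u) \<preceq> b"
    using leq_iff_diff[of u "g + b"] leq_iff_diff[of "- (g - u)" b] g 
    by (simp add: algebra_simps)
  show thesis
  proof (rule that[of u "g - u"])
    show "modulus u \<preceq> modulus x"
      unfolding a_def[symmetric] using ua au leq_minus[of "- a" u] by (intro modulus_least) auto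
    show "modulus (g - u) \<preceq> modulus y"
      unfolding b_def[symmetric] using vb bv g by (intro modulus_least) auto
  qed (use g in auto)
qed

text \<open>The join of \<open>x\<close> and \<open>y\<close> in \<open>V\<close> is \<open>x + (y - x)\<^sup>+\<close>, so closure under positive parts keeps
  it in \<open>I\<close>, where it is the least upper bound as well. Meets are joins of negatives. The operations
  of \<open>ord_on I leq\<close> are suprema computed in \<open>I\<close>, so their agreement with those of \<open>V\<close> needs proof.\<close>

lemma sublattice:
  assumes I: "subspace I" "I \<subseteq> V" and closed: "\<And>x. x \<in> I \<Longrightarrow> pos x \<in> I"
  shows "vector_lattice I leq" "\<And>x. x \<in> I \<Longrightarrow> vabs I leq x = modulus x"
proof -
  have mem: "x \<in> V" if "x \<in> I" for x using that I by auto
  let ?L = "ord_on I leq"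
  have [simp]: "carrier ?L = I" "le ?L = leq" "eq ?L = (=)" by (simp_all add: ord_on_def)
  have least: "least ?L (x + pos (y - x)) (Upper ?L {x, y})" if x: "x \<in> I" and y: "y \<in> I" for x y
  proof -
    have xyV: "x \<in> V" "y \<in> V" using x y mem by auto
    have "x + pos (y - x) \<in> I" 
      using x y I closed by (simp add: subspace_add subspace_diff)
    moreover have "x \<preceq> x + pos (y - x)"
      using leq_iff_diff[of x "x + pos (y - x)"] pos_nonneg[of "y - x"] xyV by simp
    moreover have "y \<preceq> x + pos (y - x)"
      using leq_translate[OF leq_pos[of "y - x"], of x] xyV by (simp add: add.commute)
    moreover have "x + pos (y - x) \<preceq> z" if "z \<in> I" "x \<preceq> z" "y \<preceq> z" for z
    proof -
      have z: "z \<in> V" using that mem by auto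
      have "pos (y - x) \<preceq> z - x"
        using that z xyV leq_translate[of y z "- x"] leq_iff_diff[of x z] 
        by (intro pos_least) auto
      from leq_translate[OF this, of x] show ?thesis using xyV z by (simp add: add.commute)
    qed
    ultimately show ?thesis
      unfolding least_def Upper_def using x y by auto
  qed
  have greatest: "greatest ?L (- (- x + pos (x - y))) (Lower ?L {x, y})" 
    if x: "x \<in> I" and y: "y \<in> I" for x y
  proof -
    have I': "- x \<in> I" "- y \<in> I" using x y I by (auto simp: subspace_neg)
    have flip: "- v \<preceq> - u \<longleftrightarrow> u \<preceq> v" if "u \<in> I" "v \<in> I" for u v
      using leq_iff_diff[of u v] leq_iff_diff[of "- v" "- u"] mem that by simp
    let ?u = "- x + pos (x - y)"
    have u: "?u \<in> I" "- x \<preceq> ?u" "- y \<preceq> ?u" 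
      "\<And>z. z \<in> I \<Longrightarrow> - x \<preceq> z \<Longrightarrow> - y \<preceq> z \<Longrightarrow> ?u \<preceq> z"
      using least[OF I'] I' unfolding least_def Upper_def by auto
    have nI: "- z \<in> I" if "z \<in> I" for z using that I by (simp add: subspace_neg)
    have "- ?u \<in> I" using u nI by blast
    moreover have "- ?u \<preceq> x" "- ?u \<preceq> y"
      using u(1-3) flip[of "- ?u" x] flip[of "- ?u" y] nI[OF u(1)] x y by simp_all
    moreover have "z \<preceq> - ?u" if "z \<in> I" "z \<preceq> x" "z \<preceq> y" for z
      using u(4)[of "- z"] flip[of z x] flip[of z y] flip[of z "- ?u"] nI[OF u(1)] nI that x y 
      by simp
    ultimately show ?thesis
      unfolding greatest_def Lower_def using x y by auto
  qed
  have po: "partial_order ?L"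
    by unfold_locales (auto intro: leq_antisym leq_trans mem)
  have lat: "Lattice.lattice ?L"
    by (intro Lattice.lattice.intro upper_semilattice.intro lower_semilattice.intro po
        upper_semilattice_axioms.intro lower_semilattice_axioms.intro)
      (simp_all, (blast intro: least greatest)+)
  show vl: "vector_lattice I leq"
    unfolding vector_lattice_def using lat I mem by (auto intro: leq_translate leq_scale)
  interpret I: vec_lattice I leq by unfold_locales (rule vl)
  show "vabs I leq x = modulus x" if x: "x \<in> I" for x
  proof -
    have "pos x + pos (- x) \<in> I" 
      using closed[of x] closed[of "- x"] x I by (simp add: subspace_add subspace_neg)
    then have "modulus x \<in> I" 
      using modulus_eq_pos_plus_neg x mem by simp
    then show ?thesis
      using x mem I.leq_modulus[OF x] I.minus_leq_modulus[OF x]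
      by (intro leq_antisym I.modulus_least modulus_least leq_modulus minus_leq_modulus) auto
  qed
qed

text \<open>An ideal contains \<open>x\<^sup>+\<close> together with \<open>x\<close> because \<open>|x\<^sup>+| \<le> |x|\<close>.\<close>

lemma order_ideal_sublattice:
  assumes "order_ideal I V leq"
  shows "vector_lattice I leq" "\<And>x. x \<in> I \<Longrightarrow> vabs I leq x = modulus x"
proof -
  have I: "subspace I" "I \<subseteq> V"
    and ideal: "\<And>f g. f \<in> I \<Longrightarrow> g \<in> V \<Longrightarrow> modulus g \<preceq> modulus f \<Longrightarrow> g \<in> I"
    using assms by (auto simp: order_ideal_def)
  have "pos x \<in> I" if "x \<in> I" for x
  proof (rule ideal[OF that])
    have "x \<in> V" using that I by auto
    then show "pos x \<in> V" "modulus (pos x) \<preceq> modulus x"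
      by (simp_all add: modulus_eq_self pos_nonneg pos_leq_modulus)
  qed
  with I show "vector_lattice I leq" "\<And>x. x \<in> I \<Longrightarrow> vabs I leq x = modulus x"
    by (auto dest: sublattice)
qed

end

section \<open>Equivalent norms\<close>

lemma is_norm_on_nonneg: "is_norm_on V n \<Longrightarrow> x \<in> V \<Longrightarrow> 0 \<le> n x"
  and is_norm_on_eq_0_iff: "is_norm_on V n \<Longrightarrow> x \<in> V \<Longrightarrow> n x = 0 \<longleftrightarrow> x = 0"
  and is_norm_on_scale: "is_norm_on V n \<Longrightarrow> x \<in> V \<Longrightarrow> n (c *\<^sub>R x) = \<bar>c\<bar> * n x"
  and is_norm_on_triangle: "is_norm_on V n \<Longrightarrow> x \<in> V \<Longrightarrow> y \<in> V \<Longrightarrow> n (x + y) \<le> n x + n y"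
  by (simp_all add: is_norm_on_def)

lemma is_norm_on_minus: "is_norm_on V n \<Longrightarrow> x \<in> V \<Longrightarrow> n (- x) = n x"
  using is_norm_on_scale[of V n x "- 1"] by simp

lemma Metric_space_nspace_dist:
  fixes X :: "'a::real_vector nspace"
  assumes V: "subspace (vecs X)" and n: "is_norm_on (vecs X) (nrm X)"
  shows "Metric_space (vecs X) (nspace_dist X)"
proof
  have sub: "x - y \<in> vecs X" if "x \<in> vecs X" "y \<in> vecs X" for x y
    using V that by (simp add: subspace_diff)
  show "0 \<le> nspace_dist X x y" for x y
    using n sub by (simp add: nspace_dist_def is_norm_on_def)
  show "nspace_dist X x y = nspace_dist X y x" for x y
  proof (cases "x \<in> vecs X \<and> y \<in> vecs X")
    case True
    then show ?thesis 
      using is_norm_on_minus[OF n sub, of x y] by (simp add: nspace_dist_def)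
  qed (auto simp: nspace_dist_def)
  show "nspace_dist X x y = 0 \<longleftrightarrow> x = y" if "x \<in> vecs X" "y \<in> vecs X" for x y
    using n sub that by (simp add: nspace_dist_def is_norm_on_def)
  show "nspace_dist X x z \<le> nspace_dist X x y + nspace_dist X y z"
    if "x \<in> vecs X" "y \<in> vecs X" "z \<in> vecs X" for x y z
  proof -
    have "nrm X ((x - y) + (y - z)) \<le> nrm X (x - y) + nrm X (y - z)"
      using that by (intro is_norm_on_triangle[OF n] sub)
    then show ?thesis using that by (simp add: nspace_dist_def)
  qed
qed

lemma Lipschitz_identity_continuous:
  fixes X Y :: "'a::real_vector nspace"
  assumes X: "subspace (vecs X)" "is_norm_on (vecs X) (nrm X)"
    and Y: "subspace (vecs Y)" "is_norm_on (vecs Y) (nrm Y)"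
    and sub: "vecs X \<subseteq> vecs Y" and "0 < c"
    and le: "\<And>x. x \<in> vecs X \<Longrightarrow> nrm Y x \<le> c * nrm X x"
  shows "continuous_map (nspace_topology X) (nspace_topology Y) (\<lambda>x. x)"
proof -
  have "\<exists>\<delta>>0. \<forall>x. x \<in> vecs X \<and> nspace_dist X a x < \<delta> \<longrightarrow> nspace_dist Y a x < \<epsilon>"
    if "a \<in> vecs X" "0 < \<epsilon>" for a \<epsilon>
  proof (intro exI[of _ "\<epsilon> / c"] conjI allI impI)
    show "0 < \<epsilon> / c" using that \<open>0 < c\<close> by simp
    fix x assume x: "x \<in> vecs X \<and> nspace_dist X a x < \<epsilon> / c"
    then have "nrm Y (a - x) \<le> c * nrm X (a - x)"
      using that X by (intro le) (simp add: subspace_diff)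
    also have "\<dots> < \<epsilon>"
      using x that \<open>0 < c\<close> by (auto simp: nspace_dist_def field_simps)
    finally show "nspace_dist Y a x < \<epsilon>"
      using x that sub by (auto simp: nspace_dist_def)
  qed
  then show ?thesis
    unfolding nspace_topology_def
      Metric_space.metric_continuous_map[OF Metric_space_nspace_dist[OF X] 
        Metric_space_nspace_dist[OF Y]]
    using sub by auto
qed

text \<open>Equivalent norms have the same Cauchy sequences, and the identity carries limits for one to
  limits for the other.\<close>

lemma equivalent_norm_space:
  fixes X :: "'a::real_vector nspace"
  assumes X: "banach_space X" and m: "is_norm_on (vecs X) m" 
    and eq: "equivalent_norms (vecs X) (nrm X) m"
  shows "banach_space (X\<lparr>nrm := m\<rparr>)"
    and "continuous_map (nspace_topology X) (nspace_topology (X\<lparr>nrm := m\<rparr>)) (\<lambda>x. x)"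
    and "continuous_map (nspace_topology (X\<lparr>nrm := m\<rparr>)) (nspace_topology X) (\<lambda>x. x)"
proof -
  let ?Y = "X\<lparr>nrm := m\<rparr>"
  from eq obtain c d where "c > 0" "d > 0"
    and c: "\<And>x. x \<in> vecs X \<Longrightarrow> c * nrm X x \<le> m x" 
    and d: "\<And>x. x \<in> vecs X \<Longrightarrow> m x \<le> d * nrm X x"
    unfolding equivalent_norms_def by auto
  have V: "subspace (vecs X)" and n: "is_norm_on (vecs X) (nrm X)"
    and complete: "Metric_space.mcomplete (vecs X) (nspace_dist X)"
    using X by (auto simp: banach_space_def)
  show to: "continuous_map (nspace_topology X) (nspace_topology ?Y) (\<lambda>x. x)"
    by (rule Lipschitz_identity_continuous[where c = d]) (use V n m d \<open>d > 0\<close> in auto)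
  have inv: "nrm X x \<le> inverse c * m x" if "x \<in> vecs X" for x
    using c[OF that] \<open>c > 0\<close> by (simp add: field_simps)
  show "continuous_map (nspace_topology ?Y) (nspace_topology X) (\<lambda>x. x)"
    by (rule Lipschitz_identity_continuous[where c = "inverse c"]) (use V n m inv \<open>c > 0\<close> in auto)
  interpret X: Metric_space "vecs X" "nspace_dist X"
    by (rule Metric_space_nspace_dist[OF V n])
  interpret Y: Metric_space "vecs X" "nspace_dist ?Y"
    using Metric_space_nspace_dist[of ?Y] V m by simp
  have "\<exists>x. limitin Y.mtopology \<sigma> x sequentially" if \<sigma>: "Y.MCauchy \<sigma>" for \<sigma>
  proof -
    have ran: "range \<sigma> \<subseteq> vecs X" using \<sigma> by (simp add: Y.MCauchy_def)
    have "X.MCauchy \<sigma>"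
      unfolding X.MCauchy_def
    proof (intro conjI allI impI ran)
      fix \<epsilon> :: real assume "\<epsilon> > 0"
      then have "c * \<epsilon> > 0" using \<open>c > 0\<close> by simp
      then obtain N where N: "\<And>n n'. N \<le> n \<Longrightarrow> N \<le> n' \<Longrightarrow> nspace_dist ?Y (\<sigma> n) (\<sigma> n') < c * \<epsilon>"
        using \<sigma> unfolding Y.MCauchy_def by blast
      have "nspace_dist X (\<sigma> n) (\<sigma> n') < \<epsilon>" if "N \<le> n" "N \<le> n'" for n n'
      proof -
        have mem: "\<sigma> n \<in> vecs X" "\<sigma> n' \<in> vecs X" using ran by auto
        then have "c * nrm X (\<sigma> n - \<sigma> n') < c * \<epsilon>"
          using N[OF that] c[of "\<sigma> n - \<sigma> n'"] V by (simp add: nspace_dist_def subspace_diff)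
        then show ?thesis using mem \<open>c > 0\<close> by (simp add: nspace_dist_def)
      qed
      then show "\<exists>N. \<forall>n n'. N \<le> n \<longrightarrow> N \<le> n' \<longrightarrow> nspace_dist X (\<sigma> n) (\<sigma> n') < \<epsilon>" by blast
    qed
    then obtain x where "limitin X.mtopology \<sigma> x sequentially"
      using complete unfolding X.mcomplete_def by blast
    then have "limitin (nspace_topology ?Y) ((\<lambda>x. x) \<circ> \<sigma>) x sequentially"
      using to by (intro continuous_map_limit) (auto simp: nspace_topology_def)
    then show ?thesis by (auto simp: nspace_topology_def o_def)
  qed
  then have "Y.mcomplete" by (simp add: Y.mcomplete_def)
  then show "banach_space ?Y" using V m by (simp add: banach_space_def)
qed

lemma intermediate_space_equivalent_norm:
  fixes X :: "'a::real_vector nspace"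
  assumes X: "intermediate_space X0 X1 X" and m: "is_norm_on (vecs X) m" 
    and eq: "equivalent_norms (vecs X) (nrm X) m"
  shows "intermediate_space X0 X1 (X\<lparr>nrm := m\<rparr>)"
proof -
  have "banach_space X" using X by (simp add: intermediate_space_def)
  note Y = equivalent_norm_space[OF this m eq]
  from X continuous_map_compose[OF _ Y(2), of "nspace_topology (inter_space X0 X1)" "\<lambda>x. x"]
    continuous_map_compose[OF Y(3), of "nspace_topology (sum_space X0 X1)" "\<lambda>x. x"] Y(1)
  show ?thesis
    by (auto simp: intermediate_space_def continuously_embedded_def o_def)
qed

section \<open>The K-functional of a couple of lattices\<close>

locale lattice_couple =
  fixes X0 X1 :: "'a::real_vector nspace" and leq :: "'a \<Rightarrow> 'a \<Rightarrow> bool"  (infix \<open>\<preceq>\<close> 50)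
  assumes couple: "compatible_lattice_couple X0 X1 leq"
begin

abbreviation "S \<equiv> vecs (sum_space X0 X1)"
abbreviation "K \<equiv> K_fun X0 X1"

sublocale vec_lattice S leq
  using couple by unfold_locales (simp add: compatible_lattice_couple_def banach_lattice_def)

lemma S_eq: "S = {f0 + f1 | f0 f1. f0 \<in> vecs X0 \<and> f1 \<in> vecs X1}"
  by (simp add: sum_space_def)

lemma norm_X0: "is_norm_on (vecs X0) (nrm X0)" and norm_X1: "is_norm_on (vecs X1) (nrm X1)"
  using couple 
  by (simp_all add: compatible_lattice_couple_def banach_lattice_def banach_space_def)

lemma subspace_X0: "subspace (vecs X0)" and subspace_X1: "subspace (vecs X1)"
  using couple 
  by (simp_all add: compatible_lattice_couple_def banach_lattice_def banach_space_def)

lemma X0_sub: "f \<in> vecs X0 \<Longrightarrow> f \<in> S" and X1_sub: "f \<in> vecs X1 \<Longrightarrow> f \<in> S"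
  using couple by (auto simp: compatible_lattice_couple_def order_ideal_def)

text \<open>The norm of a Banach lattice \<open>Y\<close> is monotone for the modulus formed inside \<open>Y\<close>. When \<open>Y\<close> is an
  ideal of the sum space, that modulus is the one of the sum space.\<close>

lemma ideal_norm_mono:
  assumes bl: "banach_lattice Y leq" and id: "order_ideal (vecs Y) S leq"
    and f: "f \<in> vecs Y" and g: "g \<in> S" and le: "modulus g \<preceq> modulus f"
  shows "g \<in> vecs Y" "nrm Y g \<le> nrm Y f"
proof -
  show gY: "g \<in> vecs Y" using id f g le unfolding order_ideal_def by blast
  have "vabs (vecs Y) leq g \<preceq> vabs (vecs Y) leq f"
    using order_ideal_sublattice(2)[OF id] f gY le by simp
  then show "nrm Y g \<le> nrm Y f"
    using bl f gY unfolding banach_lattice_def by blast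
qed

lemma X0_mono: "f \<in> vecs X0 \<Longrightarrow> g \<in> S \<Longrightarrow> modulus g \<preceq> modulus f \<Longrightarrow> 
    g \<in> vecs X0 \<and> nrm X0 g \<le> nrm X0 f"
  and X1_mono: "f \<in> vecs X1 \<Longrightarrow> g \<in> S \<Longrightarrow> modulus g \<preceq> modulus f \<Longrightarrow> 
    g \<in> vecs X1 \<and> nrm X1 g \<le> nrm X1 f"
  using ideal_norm_mono couple unfolding compatible_lattice_couple_def by blast+

lemma K_lower:
  assumes "f0 \<in> vecs X0" "f1 \<in> vecs X1" "0 < t"
  shows "K (f0 + f1) t \<le> nrm X0 f0 + t * nrm X1 f1"
  unfolding K_fun_def
proof (rule cInf_lower)
  show "bdd_below {nrm X0 g0 + t * nrm X1 g1 | g0 g1.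
          g0 \<in> vecs X0 \<and> g1 \<in> vecs X1 \<and> f0 + f1 = g0 + g1}"
    using norm_X0 norm_X1 \<open>0 < t\<close> by (intro bdd_belowI[of _ 0]) (auto simp: is_norm_on_def)
qed (use assms in auto)

lemma K_greatest:
  assumes "f \<in> S" 
    and "\<And>f0 f1. f0 \<in> vecs X0 \<Longrightarrow> f1 \<in> vecs X1 \<Longrightarrow> f = f0 + f1 \<Longrightarrow> z \<le> nrm X0 f0 + t * nrm X1 f1"
  shows "z \<le> K f t"
  unfolding K_fun_def by (rule cInf_greatest) (use assms in \<open>auto simp: S_eq\<close>)

lemma K_nonneg: "f \<in> S \<Longrightarrow> 0 < t \<Longrightarrow> 0 \<le> K f t"
  using norm_X0 norm_X1 by (intro K_greatest) (auto simp: is_norm_on_def)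

lemma K_zero: "K 0 t = 0" if "0 < t"
proof -
  have "nrm X0 0 = 0" "nrm X1 0 = 0"
    using is_norm_on_eq_0_iff[OF norm_X0] is_norm_on_eq_0_iff[OF norm_X1] 
      subspace_0[OF subspace_X0] subspace_0[OF subspace_X1] by simp_all
  with that show "K 0 t = 0"
    using K_lower[of 0 0 t] K_nonneg[of 0 t] subspace_0[OF subspace_X0] subspace_0[OF subspace_X1]
    by simp
qed

text \<open>Riesz decomposition turns each splitting of \<open>f\<close> into a splitting of \<open>g\<close> that is dominated
  summand by summand.\<close>

lemma K_mono:
  assumes f: "f \<in> S" and g: "g \<in> S" and le: "modulus g \<preceq> modulus f"
  shows "K_le X0 X1 g f"
  unfolding K_le_def
proof (intro allI impI K_greatest[OF f])
  fix t :: real and f0 f1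
  assume t: "0 < t" and f0: "f0 \<in> vecs X0" and f1: "f1 \<in> vecs X1" and eq: "f = f0 + f1"
  have mem: "f0 \<in> S" "f1 \<in> S" using f0 f1 X0_sub X1_sub by auto
  have "modulus g \<preceq> modulus f0 + modulus f1"
    using le modulus_triangle[OF mem] leq_trans[of "modulus g" "modulus f"] f g mem eq by simp
  then obtain g0 g1 where gi: "g0 \<in> S" "g1 \<in> S" "g = g0 + g1"
    "modulus g0 \<preceq> modulus f0" "modulus g1 \<preceq> modulus f1"
    using Riesz_decomposition[OF g mem] by blast
  then have "g0 \<in> vecs X0" "nrm X0 g0 \<le> nrm X0 f0" "g1 \<in> vecs X1" "nrm X1 g1 \<le> nrm X1 f1"
    using X0_mono[OF f0] X1_mono[OF f1] by auto
  then have "K g t \<le> nrm X0 g0 + t * nrm X1 g1" "nrm X0 g0 \<le> nrm X0 f0"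
    "t * nrm X1 g1 \<le> t * nrm X1 f1"
    using K_lower t gi(3) by (simp_all add: mult_left_mono)
  then show "K g t \<le> nrm X0 f0 + t * nrm X1 f1" by linarith
qed

lemma K_modulus:
  assumes "f \<in> S" 
  shows "K_le X0 X1 (modulus f) f" "K_le X0 X1 f (modulus f)"
  using assms by (auto intro!: K_mono)

lemma K_le_modulus_iff:
  assumes "f \<in> S" "g \<in> S" 
  shows "K_le X0 X1 (modulus g) (modulus f) \<longleftrightarrow> K_le X0 X1 g f"
  using K_modulus[OF assms(1)] K_modulus[OF assms(2)] unfolding K_le_def by (meson order_trans)

lemma K_triangle:
  assumes f: "f \<in> S" and g: "g \<in> S" and t: "0 < t"
  shows "K (f + g) t \<le> K f t + K g t"
proof -
  have 1: "K (f + g) t \<le> (nrm X0 f0 + t * nrm X1 f1) + (nrm X0 g0 + t * nrm X1 g1)"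
    if f: "f0 \<in> vecs X0" "f1 \<in> vecs X1" "f = f0 + f1" 
      and g: "g0 \<in> vecs X0" "g1 \<in> vecs X1" "g = g0 + g1" for f0 f1 g0 g1
  proof -
    have "K ((f0 + g0) + (f1 + g1)) t \<le> nrm X0 (f0 + g0) + t * nrm X1 (f1 + g1)"
      using f g t subspace_X0 subspace_X1 by (intro K_lower) (auto simp: subspace_add)
    moreover have "nrm X0 (f0 + g0) \<le> nrm X0 f0 + nrm X0 g0" 
      using norm_X0 f g by (intro is_norm_on_triangle)
    moreover have "t * nrm X1 (f1 + g1) \<le> t * (nrm X1 f1 + nrm X1 g1)" 
      using is_norm_on_triangle[OF norm_X1] f g t by (intro mult_left_mono) auto
    ultimately show ?thesis using f g by (simp add: algebra_simps)
  qed
  \<comment> \<open>The infimum over the splittings of \<open>g\<close> is taken inside the one over the splittings of \<open>f\<close>.\<close>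
  have "K (f + g) t - K g t \<le> K f t"
  proof (rule K_greatest[OF f])
    fix f0 f1 assume "f0 \<in> vecs X0" "f1 \<in> vecs X1" "f = f0 + f1"
    then have "K (f + g) t - (nrm X0 f0 + t * nrm X1 f1) \<le> K g t"
      using 1 by (intro K_greatest[OF g]) (fastforce simp: diff_le_eq add.commute)
    then show "K (f + g) t - K g t \<le> nrm X0 f0 + t * nrm X1 f1" by simp
  qed
  then show ?thesis by simp
qed

lemma K_double:
  assumes f: "f \<in> S" and t: "0 < t"
  shows "2 * K f t \<le> K (2 *\<^sub>R f) t"
proof (rule K_greatest)
  fix h0 h1 assume h: "h0 \<in> vecs X0" "h1 \<in> vecs X1" "2 *\<^sub>R f = h0 + h1"
  have "f = (1/2) *\<^sub>R 2 *\<^sub>R f" by simp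
  also have "\<dots> = (1/2) *\<^sub>R h0 + (1/2) *\<^sub>R h1" 
    by (simp only: h(3) scaleR_add_right)
  finally have eq: "f = (1/2) *\<^sub>R h0 + (1/2) *\<^sub>R h1" .
  have "K f t \<le> nrm X0 ((1/2) *\<^sub>R h0) + t * nrm X1 ((1/2) *\<^sub>R h1)"
    unfolding eq using h t subspace_X0 subspace_X1 by (intro K_lower) (auto simp: subspace_scale)
  also have "\<dots> = 1/2 * nrm X0 h0 + t * (1/2 * nrm X1 h1)"
    using is_norm_on_scale[OF norm_X0 h(1)] is_norm_on_scale[OF norm_X1 h(2)] by simp
  finally show "2 * K f t \<le> nrm X0 h0 + t * nrm X1 h1" by simp
qed (use f in simp)

lemma K_ll_iff:
  "K_ll X0 X1 leq g f \<longleftrightarrow> K_le X0 X1 (pos g) (pos f) \<and> K_le X0 X1 (neg g) (neg f)"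
  by (simp add: K_ll_def Let_def)

text \<open>The negative parts are both \<open>0\<close>, so only the comparison of the positive parts remains.\<close>

lemma K_ll_nonneg_iff:
  assumes "f \<in> S" "g \<in> S" "0 \<preceq> f" "0 \<preceq> g"
  shows "K_ll X0 X1 leq g f \<longleftrightarrow> K_le X0 X1 g f"
  using assms by (simp add: K_ll_iff pos_eq_self neg_eq_0) (simp add: K_le_def)

text \<open>The factor 2 arises because each of \<open>K(f\<^sup>+,t)\<close> and \<open>K(f\<^sup>-,t)\<close> is bounded by \<open>K(f,t)\<close>.\<close>

lemma K_ll_imp_K_le_double:
  assumes f: "f \<in> S" and g: "g \<in> S" and ll: "K_ll X0 X1 leq g f"
  shows "K_le X0 X1 g (2 *\<^sub>R f)"
  unfolding K_le_def
proof (intro allI impI)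
  fix t :: real assume t: "0 < t"
  have "K_le X0 X1 (pos f) f" "K_le X0 X1 (neg f) f"
    using f by (auto intro!: K_mono 
        simp: modulus_eq_self pos_nonneg neg_nonneg pos_leq_modulus neg_leq_modulus)
  then have "K (pos g) t \<le> K f t" "K (neg g) t \<le> K f t"
    using ll t unfolding K_ll_iff K_le_def by (meson order_trans)+
  moreover have "K g t \<le> K (modulus g) t"
    using K_modulus(2)[OF g] t by (simp add: K_le_def)
  moreover have "K (modulus g) t \<le> K (pos g) t + K (neg g) t"
    using K_triangle[of "pos g" "neg g" t] g t by (simp add: modulus_eq_pos_plus_neg)
  ultimately show "K g t \<le> K (2 *\<^sub>R f) t"
    using K_double[OF f t] by linarith
qed

end

section \<open>Monotone intermediate spaces\<close>

locale intermediate_couple = lattice_couple +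
  fixes X :: "'a nspace"
  assumes intermediate: "intermediate_space X0 X1 X"
begin

lemma banach_X: "banach_space X"
  using intermediate by (simp add: intermediate_space_def)

lemma subspace_X: "subspace (vecs X)" and norm_X: "is_norm_on (vecs X) (nrm X)"
  using banach_X by (simp_all add: banach_space_def)

lemma X_sub: "f \<in> vecs X \<Longrightarrow> f \<in> S"
  using intermediate by (auto simp: intermediate_space_def continuously_embedded_def)

lemma K_monotone_imp_partially:
  assumes "K_monotone X0 X1 X"
  shows "partially_K_monotone X0 X1 leq X"
proof -
  from assms obtain C where C: "C \<ge> 1" 
    and mono: "\<And>f g. f \<in> vecs X \<Longrightarrow> g \<in> S \<Longrightarrow> K_le X0 X1 g f \<Longrightarrow> g \<in> vecs X \<and> nrm X g \<le> C * nrm X f"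
    unfolding K_monotone_def K_monotone_with_def by blast
  have "g \<in> vecs X \<and> nrm X g \<le> 2 * C * nrm X f" 
    if f: "f \<in> vecs X" and g: "g \<in> S" and ll: "K_ll X0 X1 leq g f" for f g
  proof -
    have f2: "2 *\<^sub>R f \<in> vecs X" using f subspace_X by (simp add: subspace_scale)
    have "nrm X (2 *\<^sub>R f) = 2 * nrm X f" using is_norm_on_scale[OF norm_X f] by simp
    then show ?thesis
      using mono[OF f2 g K_ll_imp_K_le_double[OF X_sub[OF f] g ll]] by simp
  qed
  then have "partially_K_monotone_with (2 * C) X0 X1 leq X"
    by (simp add: partially_K_monotone_with_def)
  moreover have "2 * C \<ge> 1" using C by simp
  ultimately show ?thesis unfolding partially_K_monotone_def by blast
qed

text \<open>By \<open>K_mono\<close>, a vector of the sum space whose modulus is dominated by that of some \<open>f\<close> in \<open>X\<close>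
  satisfies the premise of K-monotonicity. The constant 1 makes the norm monotone.\<close>

lemma exactly_K_monotone_imp_lattice:
  assumes "exactly_K_monotone X0 X1 X"
  shows "order_ideal (vecs X) S leq" "banach_lattice X leq"
proof -
  have mono: "g \<in> vecs X \<and> nrm X g \<le> nrm X f"
    if "f \<in> vecs X" "g \<in> S" "modulus g \<preceq> modulus f" for f g
  proof -
    have "K_le X0 X1 g f" using K_mono[OF X_sub] that by blast
    then have "g \<in> vecs X \<and> nrm X g \<le> 1 * nrm X f"
      using assms that unfolding exactly_K_monotone_def K_monotone_with_def by blast
    then show ?thesis by simp
  qed
  then show id: "order_ideal (vecs X) S leq"
    using subspace_X X_sub unfolding order_ideal_def by blast
  show "banach_lattice X leq"
    unfolding banach_lattice_def
  proof (intro conjI ballI impI)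
    fix f g assume "f \<in> vecs X" "g \<in> vecs X" "vabs (vecs X) leq g \<preceq> vabs (vecs X) leq f"
    then show "nrm X g \<le> nrm X f"
      using mono[of f g] order_ideal_sublattice(2)[OF id] X_sub by simp
  qed (use banach_X order_ideal_sublattice(1)[OF id] in auto)
qed

context
  assumes partially: "exactly_partially_K_monotone X0 X1 leq X"
begin

lemma K_ll_mono: 
  assumes "f \<in> vecs X" "g \<in> S" "K_ll X0 X1 leq g f" 
  shows "g \<in> vecs X" "nrm X g \<le> nrm X f"
proof -
  have "g \<in> vecs X \<and> nrm X g \<le> 1 * nrm X f"
    using assms partially
    unfolding exactly_partially_K_monotone_def partially_K_monotone_with_def by blast
  then show "g \<in> vecs X" "nrm X g \<le> nrm X f" by simp_all
qed

lemma nonneg_K_mono: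
  assumes "f \<in> vecs X" "g \<in> S" "0 \<preceq> f" "0 \<preceq> g" "K_le X0 X1 g f" 
  shows "g \<in> vecs X" "nrm X g \<le> nrm X f"
  using K_ll_mono[OF assms(1,2)] K_ll_nonneg_iff[OF X_sub] assms by blast+

lemma nonneg_mono:
  assumes "f \<in> vecs X" "g \<in> S" "0 \<preceq> g" "g \<preceq> f" 
  shows "g \<in> vecs X" "nrm X g \<le> nrm X f"
proof -
  have f: "f \<in> S" "0 \<preceq> f" 
    using assms X_sub leq_trans[of 0 g f] by auto
  then have "K_le X0 X1 g f"
    using assms by (intro K_mono) (auto simp: modulus_eq_self)
  then show "g \<in> vecs X" "nrm X g \<le> nrm X f"
    using nonneg_K_mono[OF assms(1,2)] assms f by blast+
qed

text \<open>Here \<open>f\<^sup>+ \<ll>\<^sub>K f\<close>: the two have the same positive part, and the negative part of \<open>f\<^sup>+\<close> is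
  \<open>0\<close>.\<close>

lemma pos_bound:
  assumes f: "f \<in> vecs X" 
  shows "pos f \<in> vecs X" "nrm X (pos f) \<le> nrm X f"
proof -
  have "K_ll X0 X1 leq (pos f) f"
    using X_sub[OF f] K_zero K_nonneg
    by (simp add: K_ll_iff pos_eq_self pos_nonneg neg_eq_0) (simp add: K_le_def)
  then show "pos f \<in> vecs X" "nrm X (pos f) \<le> nrm X f"
    using K_ll_mono[OF f pos_in[OF X_sub[OF f]]] by blast+
qed

lemma neg_bound:
  assumes f: "f \<in> vecs X" 
  shows "neg f \<in> vecs X" "nrm X (neg f) \<le> nrm X f"
proof -
  have "nrm X (- f) = nrm X f"
    using norm_X f by (rule is_norm_on_minus)
  then show "neg f \<in> vecs X" "nrm X (neg f) \<le> nrm X f"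
    using pos_bound[of "- f"] f subspace_X by (simp_all add: subspace_neg)
qed

lemma modulus_bound:
  assumes f: "f \<in> vecs X" 
  shows "modulus f \<in> vecs X" "nrm X (modulus f) \<le> 2 * nrm X f"
proof -
  note parts = pos_bound[OF f] neg_bound[OF f]
  have eq: "modulus f = pos f + neg f" using X_sub[OF f] by (rule modulus_eq_pos_plus_neg)
  show "modulus f \<in> vecs X" using parts subspace_X by (simp add: eq subspace_add)
  have "nrm X (pos f + neg f) \<le> nrm X (pos f) + nrm X (neg f)"
    using norm_X parts(1,3) by (rule is_norm_on_triangle)
  then show "nrm X (modulus f) \<le> 2 * nrm X f" using parts by (simp add: eq)
qed

text \<open>Both \<open>g\<^sup>+\<close> and \<open>g\<^sup>-\<close> lie between \<open>0\<close> and \<open>|f|\<close>, which belongs to \<open>X\<close>, and \<open>g\<close> is their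
  difference. For \<open>g = f\<close> this is the upper bound of \<open>\<parallel>f\<parallel>\<close> by \<open>2 \<parallel>|f|\<parallel>\<close>.\<close>

lemma modulus_dominated:
  assumes f: "f \<in> vecs X" and g: "g \<in> S" and le: "modulus g \<preceq> modulus f"
  shows "g \<in> vecs X" "nrm X g \<le> 2 * nrm X (modulus f)"
proof -
  have "pos g \<preceq> modulus f" "neg g \<preceq> modulus f"
    using pos_leq_modulus[OF g] neg_leq_modulus[OF g] le g X_sub[OF f]
      leq_trans[of "pos g" "modulus g" "modulus f"] leq_trans[of "neg g" "modulus g" "modulus f"]
    by auto
  then have parts: "pos g \<in> vecs X" "nrm X (pos g) \<le> nrm X (modulus f)"
    "neg g \<in> vecs X" "nrm X (neg g) \<le> nrm X (modulus f)"
    using nonneg_mono[OF modulus_bound(1)[OF f]] g by (auto simp: pos_nonneg neg_nonneg)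
  then have "pos g - neg g \<in> vecs X" using subspace_X by (simp add: subspace_diff)
  then show "g \<in> vecs X" using pos_minus_neg[OF g] by simp
  have "nrm X (pos g + - neg g) \<le> nrm X (pos g) + nrm X (- neg g)"
    using parts by (intro is_norm_on_triangle[OF norm_X] subspace_neg[OF subspace_X])
  moreover have "nrm X (- neg g) = nrm X (neg g)"
    using norm_X parts by (intro is_norm_on_minus)
  ultimately show "nrm X g \<le> 2 * nrm X (modulus f)"
    using parts pos_minus_neg[OF g] by simp
qed

lemma ideal_X: "order_ideal (vecs X) S leq"
  using modulus_dominated(1) subspace_X X_sub unfolding order_ideal_def by blast

text \<open>The relation \<open>g \<preceq>\<^sub>K f\<close> passes to the moduli, which are nonnegative, so that partial
  K-monotonicity applies to them. That \<open>g\<close> itself belongs to \<open>X\<close> follows from the ideal property.\<close>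

lemma modulus_norm_mono:
  assumes "f \<in> vecs X" "g \<in> S" "K_le X0 X1 g f"
  shows "g \<in> vecs X" "nrm X (modulus g) \<le> nrm X (modulus f)"
proof -
  have "K_le X0 X1 (modulus g) (modulus f)"
    using K_le_modulus_iff[OF X_sub] assms by blast
  then have *: "modulus g \<in> vecs X" "nrm X (modulus g) \<le> nrm X (modulus f)"
    using nonneg_K_mono[OF modulus_bound(1)[OF assms(1)] modulus_in[OF assms(2)]]
      modulus_nonneg[OF X_sub[OF assms(1)]] modulus_nonneg[OF assms(2)] by blast+
  then show "nrm X (modulus g) \<le> nrm X (modulus f)" by simp
  show "g \<in> vecs X" using modulus_dominated(1)[OF *(1) assms(2)] assms by simp
qed

text \<open>The triangle inequality uses that \<open>|x + y| \<le> |x| + |y|\<close> and that the norm of \<open>X\<close> is monotone on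
  nonnegative vectors.\<close>

lemma modulus_norm_is_norm: "is_norm_on (vecs X) (\<lambda>f. nrm X (modulus f))"
  unfolding is_norm_on_def
proof (intro conjI ballI allI)
  fix x y assume x: "x \<in> vecs X" and y: "y \<in> vecs X"
  have mem: "x \<in> S" "y \<in> S" "modulus x \<in> vecs X" "modulus y \<in> vecs X"
    using x y X_sub modulus_bound by auto
  show "0 \<le> nrm X (modulus x)" using norm_X mem(3) by (rule is_norm_on_nonneg)
  show "nrm X (modulus x) = 0 \<longleftrightarrow> x = 0" 
    using is_norm_on_eq_0_iff[OF norm_X mem(3)] mem(1) by (simp add: modulus_eq_0_iff)
  show "nrm X (modulus (c *\<^sub>R x)) = \<bar>c\<bar> * nrm X (modulus x)" for c
    using is_norm_on_scale[OF norm_X mem(3)] mem(1) by (simp add: modulus_scale)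
  have "nrm X (modulus (x + y)) \<le> nrm X (modulus x + modulus y)"
    using mem(1,2) subspace_add[OF subspace_X mem(3,4)]
    by (intro nonneg_mono(2)) (simp_all add: modulus_nonneg modulus_triangle)
  also have "\<dots> \<le> nrm X (modulus x) + nrm X (modulus y)"
    using norm_X mem(3,4) by (rule is_norm_on_triangle)
  finally show "nrm X (modulus (x + y)) \<le> nrm X (modulus x) + nrm X (modulus y)" .
qed

lemma modulus_norm_bounds:
  assumes "f \<in> vecs X"
  shows "1/2 * nrm X (modulus f) \<le> nrm X f" "nrm X f \<le> 2 * nrm X (modulus f)"
  using assms modulus_bound(2)[of f] modulus_dominated(2)[of f f] X_sub by auto

lemma modulus_norm_equivalent: "equivalent_norms (vecs X) (nrm X) (\<lambda>f. nrm X (modulus f))"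
  unfolding equivalent_norms_def
  using modulus_norm_bounds by (intro exI[of _ "1/2"] exI[of _ 2] conjI) force+

lemma modulus_norm_exactly_K_monotone:
  "exactly_K_monotone X0 X1 (X\<lparr>nrm := \<lambda>f. nrm X (modulus f)\<rparr>)"
  unfolding exactly_K_monotone_def K_monotone_with_def
  by (auto dest: modulus_norm_mono)

text \<open>The vectors \<open>f\<close> and \<open>|f|\<close> have the same modulus, so each dominates the other.\<close>

lemma banach_lattice_imp_modulus_norm:
  assumes bl: "banach_lattice X leq" and f: "f \<in> vecs X"
  shows "nrm X f = nrm X (modulus f)"
  using ideal_norm_mono(2)[OF bl ideal_X, of f "modulus f"] 
    ideal_norm_mono(2)[OF bl ideal_X, of "modulus f" f] 
    f X_sub[OF f] modulus_bound(1)[OF f]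
  by simp

lemma modulus_norm_imp_exactly_K_monotone:
  assumes "\<And>f. f \<in> vecs X \<Longrightarrow> nrm X f = nrm X (modulus f)"
  shows "exactly_K_monotone X0 X1 X"
  unfolding exactly_K_monotone_def K_monotone_with_def
proof (intro ballI impI)
  fix f g assume *: "f \<in> vecs X" "g \<in> S" "K_le X0 X1 g f"
  note m = modulus_norm_mono[OF *]
  then show "g \<in> vecs X \<and> nrm X g \<le> 1 * nrm X f"
    using assms[OF *(1)] assms[OF m(1)] by simp
qed

end

end

theorem lemma2p2:
  fixes X0 X1 X :: "'a::real_vector nspace"
    and leq :: "'a \<Rightarrow> 'a \<Rightarrow> bool"
    and S :: "'a set"
    and star :: "'a \<Rightarrow> real"
  defines "S \<equiv> vecs (sum_space X0 X1)"
    and "star \<equiv> (\<lambda>f. nrm X (vabs S leq f))"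
  assumes "compatible_lattice_couple X0 X1 leq"
    and "intermediate_space X0 X1 X"
  shows
    "((\<forall>f\<in>S. \<forall>g\<in>S. K_ll X0 X1 leq g f \<longrightarrow> K_le X0 X1 g (2 *\<^sub>R f)) \<and>
      (K_monotone X0 X1 X \<longrightarrow> partially_K_monotone X0 X1 leq X)) \<and>
     (exactly_K_monotone X0 X1 X \<longrightarrow>
        banach_lattice X leq \<and> order_ideal (vecs X) S leq) \<and>
     (exactly_partially_K_monotone X0 X1 leq X \<longrightarrow>
        vector_lattice (vecs X) leq \<and> order_ideal (vecs X) S leq \<and>
        (\<forall>f\<in>vecs X. 1/2 * nrm X (vabs S leq f) \<le> nrm X f \<and>
                     nrm X f \<le> 2 * nrm X (vabs S leq f)) \<and>
        is_norm_on (vecs X) star \<and> equivalent_norms (vecs X) (nrm X) star \<and>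
        intermediate_space X0 X1 (X\<lparr>nrm := star\<rparr>) \<and>
        exactly_K_monotone X0 X1 (X\<lparr>nrm := star\<rparr>)) \<and>
     (exactly_partially_K_monotone X0 X1 leq X \<longrightarrow>
        (exactly_K_monotone X0 X1 X \<longleftrightarrow> banach_lattice X leq) \<and>
        (banach_lattice X leq \<longleftrightarrow> (\<forall>f\<in>vecs X. nrm X f = nrm X (vabs S leq f))))"
proof -
  interpret intermediate_couple X0 X1 leq X
    by unfold_locales (fact assms)+
  show ?thesis
    unfolding star_def S_def
  proof (intro conjI impI)
    assume partially: "exactly_partially_K_monotone X0 X1 leq X"
    note id = ideal_X[OF partially] and bounds = modulus_norm_bounds[OF partially]
      and norm = modulus_norm_is_norm[OF partially] 
      and equivalent = modulus_norm_equivalent[OF partially]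
    show "vector_lattice (vecs X) leq" using id by (rule order_ideal_sublattice)
    show "order_ideal (vecs X) (vecs (sum_space X0 X1)) leq" by (fact id)
    show "\<forall>f\<in>vecs X. 1/2 * nrm X (modulus f) \<le> nrm X f \<and> nrm X f \<le> 2 * nrm X (modulus f)"
      using bounds by blast
    show "is_norm_on (vecs X) (\<lambda>f. nrm X (modulus f))" by (fact norm)
    show "equivalent_norms (vecs X) (nrm X) (\<lambda>f. nrm X (modulus f))" by (fact equivalent)
    show "intermediate_space X0 X1 (X\<lparr>nrm := \<lambda>f. nrm X (modulus f)\<rparr>)"
      using intermediate norm equivalent by (rule intermediate_space_equivalent_norm)
    show "exactly_K_monotone X0 X1 (X\<lparr>nrm := \<lambda>f. nrm X (modulus f)\<rparr>)"
      using partially by (rule modulus_norm_exactly_K_monotone)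
    show "exactly_K_monotone X0 X1 X \<longleftrightarrow> banach_lattice X leq"
      and "banach_lattice X leq \<longleftrightarrow> (\<forall>f\<in>vecs X. nrm X f = nrm X (modulus f))"
      using exactly_K_monotone_imp_lattice banach_lattice_imp_modulus_norm[OF partially]
        modulus_norm_imp_exactly_K_monotone[OF partially] by blast+
  qed (use K_ll_imp_K_le_double K_monotone_imp_partially exactly_K_monotone_imp_lattice in blast)+
qed

end
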